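(* Let $H$ be a real Hilbert space, $T:H\to H$ a nonexpansive mapping, $(\beta_n)_{n\in\mathbb{N}},(\lambda_n)_{n\in\mathbb{N}}\subset(0,1]$, $x_0\in H$, and let $(x_n)$ be generated by $$x_{n+1}=\beta_n x_n+\lambda_n\big(T(\beta_n x_n)-\beta_n x_n\big)\qquad(n\in\mathbb{N}).$$ Let $N\in\mathbb{N}\setminus\{0\}$ be such that $N\ge\max\{\|x_0-p\|,\|p\|\}$ for some fixed point $p$ of $T$. Let $\ell\in\mathbb{N}\setminus\{0\}$ and let $b,D,B,L:\mathbb{N}\to\mathbb{N}$ be monotone functions such that 1. $\forall k\in\mathbb{N}\ \forall n\ge b(k)\ \big(|1-\beta_n|\le\frac{1}{k+1}\big)$; 2. $\forall k\in\mathbb{N}\ \big(\sum_{i=1}^{D(k)}(1-\beta_i)\ge k\big)$; 3. $\forall k\in\mathbb{N}\ \forall n\in\mathbb{N}\ \big(\sum_{i=B(k)+1}^{B(k)+n}|\beta_i-\beta_{i-1}|\le\frac{1}{k+1}\big)$; 4. $\forall n\in\mathbb{N}\ \big(\lambda_n\ge\frac1\ell\big)$; 5. $\forall k\in\mathbb{N}\ \forall n\in\mathbb{N}\ \big(\sum_{i=L(k)+1}^{L(k)+n}|\lambda_i-\lambda_{i-1}|\le\frac{1}{k+1}\big)$. Then (i) $\forall k\in\mathbb{N}\ \forall n\ge\nu_1(k)\ \big(\|x_{n+1}-x_n\|\le\frac{1}{k+1}\big)$, (ii) $\forall k\in\mathbb{N}\ \forall n\ge\nu_2(k)\ \big(\|T(x_n)-x_n\|\le\frac{1}{k+1}\big)$,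 where, with $G(k):=\max\{B(4N(k+1)-1),\,L(10N(k+1)-1)\}$, $$\nu_1(k):=D\big(M-1+\lceil\ln(6N(k+1))\rceil\big)+1,\quad M:=\max\{0,\,G(3k+2)+1\},$$ $$\nu_2(k):=\max\{b(4N\ell(k+1)-1),\,\nu_1(2\ell(k+1)-1)\}.$$
   Context: $\mathbb{N}=\{0,1,2,\dots\}$. A function $f:\mathbb{N}\to\mathbb{N}$ is called monotone if it is nondecreasing. *)

theory Defs
  imports "HOL-Analysis.Analysis"
begin

definition nonexpansive :: "('a::real_normed_vector \<Rightarrow> 'a) \<Rightarrow> bool" where
  "nonexpansive T \<longleftrightarrow> (\<forall>x y. norm (T x - T y) \<le> norm (x - y))"

text \<open>The rates below are natural numbers. For \<open>N > 0\<close> and \<open>l > 0\<close> none of the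
  subtractions on \<^typ>\<open>nat\<close> truncates, and the logarithm in \<open>nu1\<close> is positive, so
  the conversion by \<^const>\<open>nat\<close> does not truncate either.\<close>

definition rateG :: "nat \<Rightarrow> (nat \<Rightarrow> nat) \<Rightarrow> (nat \<Rightarrow> nat) \<Rightarrow> nat \<Rightarrow> nat" where
  "rateG N B L k = max (B (4 * N * (k + 1) - 1)) (L (10 * N * (k + 1) - 1))"

definition nu1 ::
  "nat \<Rightarrow> (nat \<Rightarrow> nat) \<Rightarrow> (nat \<Rightarrow> nat) \<Rightarrow> (nat \<Rightarrow> nat) \<Rightarrow> nat \<Rightarrow> nat" where
  "nu1 N D B L k =
     (let M = max 0 (rateG N B L (3 * k + 2) + 1)
      in D (M - 1 + nat \<lceil>ln (real (6 * N * (k + 1)))\<rceil>) + 1)"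

definition nu2 ::
  "nat \<Rightarrow> nat \<Rightarrow> (nat \<Rightarrow> nat) \<Rightarrow> (nat \<Rightarrow> nat) \<Rightarrow> (nat \<Rightarrow> nat) \<Rightarrow> (nat \<Rightarrow> nat) \<Rightarrow> nat \<Rightarrow> nat" where
  "nu2 N l b D B L k =
     max (b (4 * N * l * (k + 1) - 1)) (nu1 N D B L (2 * l * (k + 1) - 1))"

end

theory Submission
  imports Defs
begin

text \<open>
  All iterates stay in the ball of radius \<open>N\<close> around the fixed point \<open>p\<close>, so the steps
  \<open>s n = norm (x n - x (n - 1))\<close> are at most \<open>2 N\<close> and satisfy
  \<open>s (n + 1) \<le> \<beta> n * s n + 2 N * (\<bar>\<beta> n - \<beta> (n - 1)\<bar> + \<bar>lam n - lam (n - 1)\<bar>)\<close> for \<open>n \<ge> 1\<close>.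
  Iterating from index \<open>m = G (3 k + 2)\<close>, the contraction factor is at most
  \<open>exp (- (\<Sum>i=m+1..n. 1 - \<beta> i)) \<le> 1 / (6 N (k + 1))\<close>, because the first \<open>m\<close> terms use up at most
  \<open>m\<close> of the divergent sum, while the accumulated perturbation is at most
  \<open>(1 / 6 + 1 / 15) / (k + 1)\<close>. The second rate follows from the first
  since \<open>T (x n) - x n\<close> times \<open>lam n\<close> is \<open>x (n + 1) - x n\<close> up to an error of
  norm \<open>2 N (1 - \<beta> n)\<close>.
\<close>

section \<open>Real sequences: perturbed contractions and tails of sums\<close>

text \<open>Unrolling the recursion multiplies the initial value by all factors
  \<open>\<beta> i\<close>, and \<open>1 + t \<le> exp t\<close> at
  \<open>t = - (1 - \<beta> i)\<close> turns the product into the exponential of a sum. Past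
  perturbations are multiplied by factors at most 1, so they simply add up.\<close>

lemma perturbed_contraction_bound:
  fixes s \<beta> c :: "nat \<Rightarrow> real"
  assumes \<beta>: "\<And>n. 0 \<le> \<beta> n" "\<And>n. \<beta> n \<le> 1"
    and s: "\<And>n. 0 \<le> s n" and c: "\<And>n. 0 \<le> c n"
    and step: "\<And>n. n \<ge> 1 \<Longrightarrow> s (Suc n) \<le> \<beta> n * s n + c n"
  shows "s (Suc (m + j)) \<le>
    exp (- (\<Sum>i=m+1..m+j. 1 - \<beta> i)) * s (Suc m) + (\<Sum>i=m+1..m+j. c i)"
proof (induction j)
  case 0
  then show ?case by simp
next
  case (Suc j)
  let ?E = "exp (- (\<Sum>i=m+1..m+j. 1 - \<beta> i)) * s (Suc m)"
  let ?C = "\<Sum>i=m+1..m+j. c i"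
  let ?n = "Suc (m + j)"
  have exp_ge: "\<beta> ?n \<le> exp (- (1 - \<beta> ?n))"
    using exp_ge_add_one_self[of "- (1 - \<beta> ?n)"] by simp
  have "0 \<le> ?C" "0 \<le> ?E"
    using c s by (auto intro: sum_nonneg)
  have "s (Suc ?n) \<le> \<beta> ?n * s ?n + c ?n"
    by (rule step) simp
  also have "\<dots> \<le> \<beta> ?n * (?E + ?C) + c ?n"
    using Suc.IH \<beta> by (simp add: mult_left_mono)
  also have "\<dots> = \<beta> ?n * ?E + \<beta> ?n * ?C + c ?n"
    by (simp add: algebra_simps)
  also have "\<dots> \<le> exp (- (1 - \<beta> ?n)) * ?E + 1 * ?C + c ?n"
    using exp_ge \<beta> \<open>0 \<le> ?C\<close> \<open>0 \<le> ?E\<close> by (intro add_mono mult_right_mono order_refl) auto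
  also have "\<dots> = exp (- (\<Sum>i=m+1..m+Suc j. 1 - \<beta> i)) * s (Suc m) + (\<Sum>i=m+1..m+Suc j. c i)"
    by (simp add: exp_add [symmetric] mult.assoc [symmetric] algebra_simps)
  finally show ?case by simp
qed

text \<open>A Cauchy rate given at \<open>K\<close> is needed at a later start \<open>m\<close>,
  since \<open>rateG\<close> is a maximum of two such indices. The shifted range lies in a longer
  one starting at \<open>K + 1\<close>.\<close>

lemma sum_tail_le:
  fixes f :: "nat \<Rightarrow> real"
  assumes "\<And>n. 0 \<le> f n" and "\<And>n. (\<Sum>i=K+1..K+n. f i) \<le> e" and "K \<le> m"
  shows "(\<Sum>i=m+1..m+j. f i) \<le> e"
proof -
  have "(\<Sum>i=m+1..m+j. f i) \<le> (\<Sum>i=K+1..K+(m-K+j). f i)"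
    using assms by (intro sum_mono2) auto
  also have "\<dots> \<le> e" by (rule assms)
  finally show ?thesis .
qed

text \<open>Each term is at most 1, so reaching \<open>q\<close> takes at least \<open>q\<close>
  terms.\<close>

lemma divergence_rate_ge:
  fixes \<beta> :: "nat \<Rightarrow> real"
  assumes "\<And>n. 0 \<le> \<beta> n" and "real q \<le> (\<Sum>i=1..D. 1 - \<beta> i)"
  shows "q \<le> D"
proof -
  have "(\<Sum>i=1..D. 1 - \<beta> i) \<le> (\<Sum>i=1..D. 1)"
    using assms by (intro sum_mono) auto
  with assms have "real q \<le> real D" by simp
  then show ?thesis by simp
qed

lemma sum_complement_tail_ge:
  fixes \<beta> :: "nat \<Rightarrow> real"
  assumes \<beta>: "\<And>n. 0 \<le> \<beta> n" "\<And>n. \<beta> n \<le> 1"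
    and D: "real (m + r) \<le> (\<Sum>i=1..D. 1 - \<beta> i)" and "D \<le> m + j"
  shows "real r \<le> (\<Sum>i=m+1..m+j. 1 - \<beta> i)"
proof -
  have "(\<Sum>i=1..D. 1 - \<beta> i) \<le> (\<Sum>i=1..m+j. 1 - \<beta> i)"
    using \<beta> \<open>D \<le> m + j\<close> by (intro sum_mono2) auto
  also have "\<dots> = (\<Sum>i=1..m. 1 - \<beta> i) + (\<Sum>i=m+1..m+j. 1 - \<beta> i)"
    by (rule sum.ub_add_nat) simp
  also have "(\<Sum>i=1..m. 1 - \<beta> i) \<le> (\<Sum>i=1..m. 1)"
    using \<beta> by (intro sum_mono) auto
  finally show ?thesis using D by simp
qed

section \<open>Convex combinations and nonexpansive maps\<close>

lemma nonexpansiveD: "nonexpansive T \<Longrightarrow> norm (T u - T v) \<le> norm (u - v)"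
  by (simp add: nonexpansive_def)

text \<open>Scaling moves \<open>u\<close> towards 0, so the difference to \<open>p\<close> is a
  convex combination of \<open>u - p\<close> and \<open>- p\<close>; this is why \<open>R\<close>
  must also bound \<open>norm p\<close>.\<close>

lemma norm_scaled_diff_le:
  fixes u p :: "'a::real_normed_vector"
  assumes "0 \<le> t" "t \<le> 1" "norm (u - p) \<le> R" "norm p \<le> R"
  shows "norm (t *\<^sub>R u - p) \<le> R"
proof -
  have "t *\<^sub>R u - p = t *\<^sub>R (u - p) + (1 - t) *\<^sub>R (- p)"
    by (simp add: algebra_simps)
  then have "norm (t *\<^sub>R u - p) \<le> norm (t *\<^sub>R (u - p)) + norm ((1 - t) *\<^sub>R (- p))"
    by (metis norm_triangle_ineq)
  also have "\<dots> \<le> t * R + (1 - t) * R"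
    using assms by (intro add_mono) (simp_all add: mult_left_mono)
  finally show ?thesis by (simp add: algebra_simps)
qed

lemma norm_averaged_diff_le:
  fixes T :: "'a::real_normed_vector \<Rightarrow> 'a"
  assumes "nonexpansive T" "0 \<le> t" "t \<le> 1"
  shows "norm ((y + t *\<^sub>R (T y - y)) - (z + t *\<^sub>R (T z - z))) \<le> norm (y - z)"
proof -
  have "(y + t *\<^sub>R (T y - y)) - (z + t *\<^sub>R (T z - z)) = (1 - t) *\<^sub>R (y - z) + t *\<^sub>R (T y - T z)"
    by (simp add: algebra_simps)
  then have "norm ((y + t *\<^sub>R (T y - y)) - (z + t *\<^sub>R (T z - z)))
      \<le> norm ((1 - t) *\<^sub>R (y - z)) + norm (t *\<^sub>R (T y - T z))"
    by (metis norm_triangle_ineq)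
  also have "\<dots> \<le> (1 - t) * norm (y - z) + t * norm (y - z)"
    using assms nonexpansiveD[OF assms(1), of y z]
    by (intro add_mono) (simp_all add: mult_left_mono)
  finally show ?thesis by (simp add: algebra_simps)
qed

section \<open>Norm estimates along the iteration, before any rates enter\<close>

locale scaled_KM_iteration =
  fixes T :: "'a::real_normed_vector \<Rightarrow> 'a" and \<beta> lam :: "nat \<Rightarrow> real"
    and x :: "nat \<Rightarrow> 'a" and p :: 'a and R :: real
  assumes nonexp: "nonexpansive T"
    and \<beta>: "0 \<le> \<beta> n" "\<beta> n \<le> 1"
    and lam: "0 \<le> lam n" "lam n \<le> 1"
    and x_Suc: "x (Suc n) = \<beta> n *\<^sub>R x n + lam n *\<^sub>R (T (\<beta> n *\<^sub>R x n) - \<beta> n *\<^sub>R x n)"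
    and fix_p: "T p = p" and init: "norm (x 0 - p) \<le> R" and norm_p: "norm p \<le> R"
begin

lemma norm_iterate_diff_le: "norm (x n - p) \<le> R"
proof (induction n)
  case 0
  show ?case by (rule init)
next
  case (Suc n)
  have "norm (x (Suc n) - p) \<le> norm (\<beta> n *\<^sub>R x n - p)"
    using norm_averaged_diff_le[OF nonexp lam[of n], of "\<beta> n *\<^sub>R x n" p]
    by (simp add: x_Suc fix_p)
  also have "\<dots> \<le> R"
    by (rule norm_scaled_diff_le[OF \<beta> Suc.IH norm_p])
  finally show ?case .
qed

lemma norm_scaled_iterate_diff_le: "norm (\<beta> n *\<^sub>R x n - p) \<le> R"
  by (rule norm_scaled_diff_le[OF \<beta> norm_iterate_diff_le norm_p])

lemma norm_iterate_le: "norm (x n) \<le> 2 * R"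
  using norm_triangle_ineq[of "x n - p" p] norm_iterate_diff_le[of n] norm_p by simp

lemma norm_step_le: "norm (x n - x m) \<le> 2 * R"
  using norm_triangle_ineq4[of "x n - p" "x m - p"] norm_iterate_diff_le[of n]
    norm_iterate_diff_le[of m] by simp

lemma norm_residual_le: "norm (T (\<beta> n *\<^sub>R x n) - \<beta> n *\<^sub>R x n) \<le> 2 * R"
proof -
  have "norm (T (\<beta> n *\<^sub>R x n) - T p) \<le> R"
    using nonexpansiveD[OF nonexp] norm_scaled_iterate_diff_le order_trans by blast
  then show ?thesis
    using norm_triangle_ineq4[of "T (\<beta> n *\<^sub>R x n) - p" "\<beta> n *\<^sub>R x n - p"]
      norm_scaled_iterate_diff_le[of n] by (simp add: fix_p)
qed

lemma norm_step_recursion: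
  "norm (x (Suc (Suc n)) - x (Suc n)) \<le> \<beta> (Suc n) * norm (x (Suc n) - x n)
     + 2 * R * (\<bar>\<beta> (Suc n) - \<beta> n\<bar> + \<bar>lam (Suc n) - lam n\<bar>)"
proof -
  let ?y = "\<lambda>n. \<beta> n *\<^sub>R x n" and ?t = "lam (Suc n)"
  let ?A = "\<lambda>v. v + ?t *\<^sub>R (T v - v)"
  have "x (Suc (Suc n)) = ?A (?y (Suc n))"
    by (rule x_Suc)
  \<comment> \<open>Rewriting the older iterate with the newer parameter makes both iterates images
    under the same nonexpansive map \<open>?A\<close>; the change of parameter costs a multiple of
    the bounded residual.\<close>
  moreover have "x (Suc n) = ?A (?y n) - (?t - lam n) *\<^sub>R (T (?y n) - ?y n)"
    by (simp add: x_Suc scaleR_left_diff_distrib)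
  ultimately have "x (Suc (Suc n)) - x (Suc n)
      = (?A (?y (Suc n)) - ?A (?y n)) + (?t - lam n) *\<^sub>R (T (?y n) - ?y n)"
    by (simp only: diff_diff_eq2 diff_add_eq)
  then have "norm (x (Suc (Suc n)) - x (Suc n))
      \<le> norm (?A (?y (Suc n)) - ?A (?y n)) + norm ((?t - lam n) *\<^sub>R (T (?y n) - ?y n))"
    by (metis norm_triangle_ineq)
  also have "\<dots> \<le> norm (?y (Suc n) - ?y n) + \<bar>?t - lam n\<bar> * (2 * R)"
    using norm_averaged_diff_le[OF nonexp lam[of "Suc n"]] norm_residual_le[of n]
    by (intro add_mono) (simp_all add: mult_left_mono)
  \<comment> \<open>This split puts the contraction factor \<open>\<beta> (Suc n)\<close> on the
    previous step and leaves a remainder governed by the variation of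
    \<open>\<beta>\<close>.\<close>
  also have "?y (Suc n) - ?y n = \<beta> (Suc n) *\<^sub>R (x (Suc n) - x n) + (\<beta> (Suc n) - \<beta> n) *\<^sub>R x n"
    by (simp add: algebra_simps)
  also have "norm \<dots> \<le> norm (\<beta> (Suc n) *\<^sub>R (x (Suc n) - x n)) + norm ((\<beta> (Suc n) - \<beta> n) *\<^sub>R x n)"
    by (rule norm_triangle_ineq)
  also have "\<dots> \<le> \<beta> (Suc n) * norm (x (Suc n) - x n) + \<bar>\<beta> (Suc n) - \<beta> n\<bar> * (2 * R)"
    using \<beta> norm_iterate_le by (intro add_mono) (simp_all add: mult_left_mono)
  finally show ?thesis by (simp add: algebra_simps)
qed

lemma lam_mult_displacement_le:
  "lam n * norm (T (x n) - x n) \<le> norm (x (Suc n) - x n) + 2 * R * (1 - \<beta> n)"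
proof -
  let ?y = "\<beta> n *\<^sub>R x n"
  have gap: "norm (x n - ?y) \<le> (1 - \<beta> n) * (2 * R)"
  proof -
    have "x n - ?y = (1 - \<beta> n) *\<^sub>R x n" by (simp add: algebra_simps)
    then show ?thesis using \<beta>[of n] norm_iterate_le[of n] by (simp add: mult_left_mono)
  qed
  \<comment> \<open>The weights \<open>lam n\<close> and \<open>1 - lam n\<close> add up to 1, so by
    nonexpansiveness the two error terms together cost only one
    \<open>norm (x n - ?y)\<close>.\<close>
  have "lam n *\<^sub>R (T (x n) - x n)
      = (x (Suc n) - x n) + (lam n *\<^sub>R (T (x n) - T ?y) + (1 - lam n) *\<^sub>R (x n - ?y))"
    by (simp add: x_Suc algebra_simps)
  then have "norm (lam n *\<^sub>R (T (x n) - x n)) \<le> norm (x (Suc n) - x n)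
      + (norm (lam n *\<^sub>R (T (x n) - T ?y)) + norm ((1 - lam n) *\<^sub>R (x n - ?y)))"
    by (metis add_left_mono norm_triangle_ineq order_trans)
  also have "\<dots> \<le> norm (x (Suc n) - x n) + (lam n * norm (x n - ?y) + (1 - lam n) * norm (x n - ?y))"
    using lam[of n] nonexpansiveD[OF nonexp, of "x n" ?y]
    by (intro add_mono order_refl) (simp_all add: mult_left_mono)
  also have "\<dots> = norm (x (Suc n) - x n) + norm (x n - ?y)"
    by (simp add: algebra_simps)
  finally show ?thesis using gap lam[of n] by (simp add: mult.commute)
qed

lemma norm_step_le_tail:
  "norm (x (Suc (m + j)) - x (m + j)) \<le> exp (- (\<Sum>i=m+1..m+j. 1 - \<beta> i)) * (2 * R)
     + 2 * R * ((\<Sum>i=m+1..m+j. \<bar>\<beta> i - \<beta> (i - 1)\<bar>) + (\<Sum>i=m+1..m+j. \<bar>lam i - lam (i - 1)\<bar>))"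
proof -
  have R: "0 \<le> R" using norm_p norm_ge_zero order_trans by blast
  let ?s = "\<lambda>n. norm (x n - x (n - 1))"
  let ?c = "\<lambda>n. 2 * R * (\<bar>\<beta> n - \<beta> (n - 1)\<bar> + \<bar>lam n - lam (n - 1)\<bar>)"
  \<comment> \<open>At \<open>n = 0\<close> truncated subtraction makes both \<open>?s 0\<close> and
    \<open>?c 0\<close> vanish, so the recursion is claimed only from 1 on.\<close>
  have step: "?s (Suc n) \<le> \<beta> n * ?s n + ?c n" if "n \<ge> 1" for n
    using that norm_step_recursion[of "n - 1"] by simp
  have "?s (Suc (m + j)) \<le> exp (- (\<Sum>i=m+1..m+j. 1 - \<beta> i)) * ?s (Suc m) + (\<Sum>i=m+1..m+j. ?c i)"
    using R by (intro perturbed_contraction_bound \<beta> step) auto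
  also have "\<dots> \<le> exp (- (\<Sum>i=m+1..m+j. 1 - \<beta> i)) * (2 * R) + (\<Sum>i=m+1..m+j. ?c i)"
    using norm_step_le by (intro add_mono mult_left_mono) auto
  finally show ?thesis
    by (simp add: sum_distrib_left [symmetric] sum.distrib)
qed

end

section \<open>The two explicit rates\<close>

theorem lemma3p3:
  fixes T :: "'a::{real_inner, complete_space} \<Rightarrow> 'a"
    and \<beta> lam :: "nat \<Rightarrow> real"
    and x0 :: 'a
    and x :: "nat \<Rightarrow> 'a"
    and N l :: nat
    and b D B L :: "nat \<Rightarrow> nat"
  assumes "nonexpansive T"
    and "\<And>n. \<beta> n \<in> {0<..1}"
    and "\<And>n. lam n \<in> {0<..1}"
    and "x 0 = x0"
    and "\<And>n. x (Suc n) =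
           \<beta> n *\<^sub>R x n + lam n *\<^sub>R (T (\<beta> n *\<^sub>R x n) - \<beta> n *\<^sub>R x n)"
    and "N \<noteq> 0"
    and "\<exists>p. T p = p \<and> real N \<ge> max (norm (x0 - p)) (norm p)"
    and "l \<noteq> 0"
    and "mono b" and "mono D" and "mono B" and "mono L"
    and "\<forall>k. \<forall>n\<ge>b k. \<bar>1 - \<beta> n\<bar> \<le> 1 / (real k + 1)"
    and "\<forall>k. (\<Sum>i=1..D k. 1 - \<beta> i) \<ge> real k"
    and "\<forall>k n. (\<Sum>i=B k + 1..B k + n. \<bar>\<beta> i - \<beta> (i - 1)\<bar>) \<le> 1 / (real k + 1)"
    and "\<forall>n. lam n \<ge> 1 / real l"
    and "\<forall>k n. (\<Sum>i=L k + 1..L k + n. \<bar>lam i - lam (i - 1)\<bar>) \<le> 1 / (real k + 1)"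
  shows "(\<forall>k. \<forall>n\<ge>nu1 N D B L k. norm (x (Suc n) - x n) \<le> 1 / (real k + 1)) \<and>
         (\<forall>k. \<forall>n\<ge>nu2 N l b D B L k. norm (T (x n) - x n) \<le> 1 / (real k + 1))"
proof -
  have real_pred_add_one: "real (m - 1) + 1 = real m" if "m > 0" for m
    using that by simp
  have N: "real N > 0" and l: "real l > 0"
    and b: "\<And>k n. n \<ge> b k \<Longrightarrow> \<bar>1 - \<beta> n\<bar> \<le> 1 / (real k + 1)"
    and D: "\<And>k. (\<Sum>i=1..D k. 1 - \<beta> i) \<ge> real k"
    and B: "\<And>k n. (\<Sum>i=B k + 1..B k + n. \<bar>\<beta> i - \<beta> (i - 1)\<bar>) \<le> 1 / (real k + 1)"
    and lam_ge: "\<And>n. lam n \<ge> 1 / real l"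
    and L: "\<And>k n. (\<Sum>i=L k + 1..L k + n. \<bar>lam i - lam (i - 1)\<bar>) \<le> 1 / (real k + 1)"
    using assms by auto
  obtain p where "T p = p" "norm (x0 - p) \<le> real N" "norm p \<le> real N"
    using assms(7) by auto
  then interpret scaled_KM_iteration T \<beta> lam x p "real N"
    using assms(1-5) by unfold_locales (simp_all add: less_imp_le)
  have rate1: "norm (x (Suc n) - x n) \<le> 1 / (real k + 1)" if n: "n \<ge> nu1 N D B L k" for k n
  proof -
    \<comment> \<open>This is \<open>M - 1\<close> from \<open>nu1\<close>; \<open>r\<close> is
      chosen so that \<open>exp (- r)\<close> is at most \<open>1 / (6 N (k + 1))\<close>, which
      leaves \<open>1 / (3 (k + 1))\<close> after multiplication by \<open>2 N\<close>.\<close>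
    define m where "m = rateG N B L (3 * k + 2)"
    define r where "r = nat \<lceil>ln (real (6 * N * (k + 1)))\<rceil>"
    have "D (m + r) \<le> n"
      using n by (simp add: nu1_def m_def r_def)
    moreover have "m + r \<le> D (m + r)"
      by (rule divergence_rate_ge[OF _ D]) (rule \<beta>)
    ultimately obtain j where j: "n = m + j"
      using le_Suc_ex[of m n] by auto
    have "real r \<le> (\<Sum>i=m+1..m+j. 1 - \<beta> i)"
      by (rule sum_complement_tail_ge[OF \<beta> D]) (use \<open>D (m + r) \<le> n\<close> j in simp)
    moreover have "ln (real (6 * N * (k + 1))) \<le> real r"
      unfolding r_def by linarith
    ultimately have "exp (- (\<Sum>i=m+1..m+j. 1 - \<beta> i)) \<le> exp (- ln (real (6 * N * (k + 1))))"
      by simp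
    also have "\<dots> = 1 / (6 * real N * (real k + 1))"
    proof -
      have "real (6 * N * (k + 1)) > 0" using N by (simp only: of_nat_0_less_iff) simp
      then show ?thesis by (simp add: exp_minus inverse_eq_divide algebra_simps)
    qed
    finally have "exp (- (\<Sum>i=m+1..m+j. 1 - \<beta> i)) * (2 * real N)
        \<le> 1 / (6 * real N * (real k + 1)) * (2 * real N)"
      by (rule mult_right_mono) simp
    also have "\<dots> = 1 / (3 * (real k + 1))"
      using N by (simp add: divide_simps)
    finally have contr: "exp (- (\<Sum>i=m+1..m+j. 1 - \<beta> i)) * (2 * real N) \<le> 1 / (3 * (real k + 1))" .
    \<comment> \<open>For \<open>c = 4\<close> and \<open>c = 10\<close>: the \<open>- 1\<close> in
      \<open>rateG\<close> cancels the \<open>+ 1\<close> in the Cauchy rates, and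
      \<open>3 k + 2 + 1 = 3 (k + 1)\<close>.\<close>
    have shift: "real (c * N * (3 * k + 2 + 1) - 1) + 1 = 3 * real c * real N * (real k + 1)"
      if "c > 0" for c
    proof -
      have "c * N * (3 * k + 2 + 1) > 0" using that N by (intro mult_pos_pos) auto
      from real_pred_add_one[OF this] show ?thesis
        by (simp add: algebra_simps)
    qed
    have var\<beta>: "(\<Sum>i=m+1..m+j. \<bar>\<beta> i - \<beta> (i - 1)\<bar>) \<le> 1 / (12 * real N * (real k + 1))"
    proof (rule sum_tail_le[OF abs_ge_zero])
      let ?K = "4 * N * (3 * k + 2 + 1) - 1"
      show "(\<Sum>i=B ?K+1..B ?K+n. \<bar>\<beta> i - \<beta> (i - 1)\<bar>) \<le> 1 / (12 * real N * (real k + 1))" for n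
        using B[of ?K n] by (subst (asm) shift) simp_all
    qed (simp add: m_def rateG_def)
    have varlam: "(\<Sum>i=m+1..m+j. \<bar>lam i - lam (i - 1)\<bar>) \<le> 1 / (30 * real N * (real k + 1))"
    proof (rule sum_tail_le[OF abs_ge_zero])
      let ?K = "10 * N * (3 * k + 2 + 1) - 1"
      show "(\<Sum>i=L ?K+1..L ?K+n. \<bar>lam i - lam (i - 1)\<bar>) \<le> 1 / (30 * real N * (real k + 1))" for n
        using L[of ?K n] by (subst (asm) shift) simp_all
    qed (simp add: m_def rateG_def)
    have "norm (x (Suc n) - x n) \<le> 1 / (3 * (real k + 1))
        + 2 * real N * (1 / (12 * real N * (real k + 1)) + 1 / (30 * real N * (real k + 1)))"
      unfolding j by (rule order_trans[OF norm_step_le_tail])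
        (intro add_mono contr mult_left_mono var\<beta> varlam, simp)
    \<comment> \<open>\<open>1/3 + 1/6 + 1/15 = 17/30\<close>.\<close>
    also have "\<dots> = (17 / 30) / (real k + 1)"
      using N by (simp add: divide_simps) (simp add: algebra_simps)
    also have "\<dots> \<le> 1 / (real k + 1)"
      by (intro divide_right_mono) auto
    finally show ?thesis .
  qed
  have rate2: "norm (T (x n) - x n) \<le> 1 / (real k + 1)" if n: "n \<ge> nu2 N l b D B L k" for k n
  proof -
    have pos: "4 * N * l * (k + 1) > 0" "2 * l * (k + 1) > 0"
      using N l by (auto intro!: mult_pos_pos)
    have shift: "real (4 * N * l * (k + 1) - 1) + 1 = 4 * real N * real l * (real k + 1)"
        "real (2 * l * (k + 1) - 1) + 1 = 2 * real l * (real k + 1)"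
      unfolding real_pred_add_one[OF pos(1)] real_pred_add_one[OF pos(2)] by (simp_all add: algebra_simps)
    \<comment> \<open>Dividing by \<open>lam n \<ge> 1 / l\<close> costs a factor \<open>l\<close>,
      so the step and the scaling error are each made at most
      \<open>1 / (2 l (k + 1))\<close>.\<close>
    have "\<bar>1 - \<beta> n\<bar> \<le> 1 / (4 * real N * real l * (real k + 1))"
      using b[of "4 * N * l * (k + 1) - 1" n] n unfolding nu2_def shift by simp
    then have "2 * real N * (1 - \<beta> n) \<le> 2 * real N * (1 / (4 * real N * real l * (real k + 1)))"
      by (intro mult_left_mono) auto
    moreover have "norm (x (Suc n) - x n) \<le> 1 / (2 * real l * (real k + 1))"
      using rate1[of "2 * l * (k + 1) - 1" n] n unfolding nu2_def shift by simp
    moreover have "1 / real l * norm (T (x n) - x n) \<le> lam n * norm (T (x n) - x n)"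
      by (intro mult_right_mono lam_ge) simp
    ultimately have "1 / real l * norm (T (x n) - x n) \<le>
        1 / (2 * real l * (real k + 1)) + 2 * real N * (1 / (4 * real N * real l * (real k + 1)))"
      using lam_mult_displacement_le[of n] by linarith
    also have "\<dots> = 1 / real l * (1 / (real k + 1))"
      using N l by (simp add: divide_simps)
    finally show ?thesis
      by (rule mult_left_le_imp_le) (use l in simp)
  qed
  show ?thesis using rate1 rate2 by blast
qed

end
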